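(* Let $G$ be a finitely generated countable discrete amenable group with a finite generating set $\mathfrak{G}$, let $\{F_n\}_{n\in\mathbb{N}}$ be a Følner sequence in $G$, and let $(X,G)$ be a Lipschitz $G$-system, i.e. $X$ is a compact metric space with metric $d$ on which $G$ acts by homeomorphisms such that every $t\in\mathfrak{G}$ acts as a bi-Lipschitz homeomorphism. Let $s\in\mathcal{S}^*$ and $\varphi\in C(X,\mathbb{R})$. Then $$SP(\varphi,s)=PSP(\varphi,s).$$
   Context: A Følner sequence in $G$ is a sequence $\{F_n\}_{n\in\mathbb{N}}$ of nonempty finite subsets of $G$ with $\lim_{n\to\infty}|F_n\triangle gF_n|/|F_n|=0$ for all $g\in G$. Scale functions: $\mathcal{S}$ is the set of functions $s:(0,1)\to(0,\infty)$ such that $\lim_{x\to0}s(\lambda x)/s(x)=1$ for every $\lambda\in(0,\infty)$; $\mathcal{S}^*$ is the set of non-increasing $s\in\mathcal{S}$. Scale pressure: For a nonempty finite $F\subseteq G$ let $d_F(x,y)=\max_{g\in F}d(gx,gy)$. A set $J\subseteq X$ is an $(F,\varepsilon)$-spanning set of $X$ if for every $x\in X$ there is $y\in J$ with $d_F(x,y)<\varepsilon$. Let $S_{F_n,\varphi}(x)=\sum_{g\in F_n}\varphi(gx)$ and, for $\varepsilon\in(0,1)$, $$Q_{\varepsilon,F_n}(\varphi,s)=\inf\Big\{\sum_{x\in J}\exp(s(\varepsilon)S_{F_n,\varphi}(x)): J\text{ is an }(F_n,\varepsilon)\text{-spanning set of }X\Big\},$$ $$SP(\varphi,s)=Q(\varphi,s)=\limsup_{\varepsilon\to0}\frac{\limsup_{n\to\infty}\frac1{|F_n|}\log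 Q_{\varepsilon,F_n}(\varphi,s)}{s(\varepsilon)}.$$ Scale pressure with respect to pseudo-orbits: For $\theta>0$, a family $(y_g)_{g\in G}\in X^G$ is a $\theta$-pseudo orbit (with respect to $\mathfrak{G}$) if $d(y_{tg},t(y_g))<\theta$ for all $t\in\mathfrak{G}$, $g\in G$; $PO_\theta(\mathfrak{G})\subseteq X^G$ denotes the set of all $\theta$-pseudo orbits. For $K\subseteq X^G$ and finite nonempty $F\subseteq G$, a set $J\subseteq X^G$ is an $(F,\varepsilon)$ spanning set of $K$ if for every $(x_g)_{g\in G}\in K$ there is $(y_g)_{g\in G}\in J$ with $d(x_g,y_g)\le\varepsilon$ for all $g\in F$. For nonempty $Y\subseteq PO_\theta(\mathfrak{G})$ let $$POQ_{\varepsilon,F_n}(Y,G,\varphi,s)=\inf\Big\{\sum_{(x_g)_{g\in G}\in J}\exp\Big(s(\varepsilon)\sum_{g\in F_n}\varphi(x_g)\Big): J\text{ is an }(F_n,\varepsilon)\text{ spanning set of }Y\Big\},$$ and $$PSP(\varphi,s)=POQ(\varphi,s)=\limsup_{\varepsilon\to0}\frac{\limsup_{n\to\infty}\frac1{|F_n|}\log\big(\lim_{\theta\to0}POQ_{\varepsilon,F_n}(PO_\theta(\mathfrak{G}),G,\varphi,s)\big)}{s(\varepsilon)}.$$ *)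

theory Defs
  imports "HOL-Analysis.Analysis" "HOL-Algebra.Group_Action" "HOL-Algebra.Generated_Groups"
begin

subsection \<open>Amenable groups\<close>

definition folner_sequence :: "('g, 'b) monoid_scheme \<Rightarrow> (nat \<Rightarrow> 'g set) \<Rightarrow> bool" where
  "folner_sequence G F \<longleftrightarrow>
     (\<forall>n. F n \<noteq> {} \<and> finite (F n) \<and> F n \<subseteq> carrier G) \<and>
     (\<forall>g\<in>carrier G.
        (\<lambda>n. real (card (sym_diff (F n) (g <#\<^bsub>G\<^esub> F n))) / real (card (F n))) \<longlonglongrightarrow> 0)"

locale countable_amenable_group = group +
  assumes countable_carrier: "countable (carrier G)"
    and ex_folner_sequence: "\<exists>F. folner_sequence G F"

subsection \<open>Lipschitz systems\<close>

definition bi_lipschitz_homeomorphism :: "'x::metric_space set \<Rightarrow> ('x \<Rightarrow> 'x) \<Rightarrow> bool" where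
  "bi_lipschitz_homeomorphism X f \<longleftrightarrow>
     (\<exists>f'. homeomorphism X X f f' \<and> (\<exists>C. C-lipschitz_on X f) \<and> (\<exists>C. C-lipschitz_on X f'))"

text \<open>
  The generating set generates the carrier as a group: inverses of generators may be used.
\<close>

locale lipschitz_system = group_action G X act
  for G (structure) and gens :: "'g set" and X :: "'x::metric_space set"
    and act :: "'g \<Rightarrow> 'x \<Rightarrow> 'x" +
  assumes finite_gens: "finite gens"
    and gens_subset: "gens \<subseteq> carrier G"
    and generate_gens: "generate G gens = carrier G"
    and compact_space: "compact X"
    and act_homeomorphism: "g \<in> carrier G \<Longrightarrow> homeomorphism X X (act g) (act (inv g))"
    and gens_bi_lipschitz: "t \<in> gens \<Longrightarrow> bi_lipschitz_homeomorphism X (act t)"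

subsection \<open>Scale functions\<close>

text \<open>
  Only the values on \<open>(0, 1)\<close> are constrained or used. For fixed \<open>l\<close> the argument \<open>l * x\<close>
  lies in \<open>(0, 1)\<close> once \<open>x\<close> is close to \<open>0\<close>.
\<close>

definition scale_functions :: "(real \<Rightarrow> real) set" where
  "scale_functions =
     {s. (\<forall>x\<in>{0<..<1}. 0 < s x) \<and> (\<forall>l>0. ((\<lambda>x. s (l * x) / s x) \<longlongrightarrow> 1) (at_right 0))}"

definition noninc_scale_functions :: "(real \<Rightarrow> real) set" where
  "noninc_scale_functions = {s \<in> scale_functions. antimono_on {0<..<1} s}"

subsection \<open>Extended logarithm\<close>

text \<open>
  Spanning sets may be infinite, so the sums over them are taken in \<^typ>\<open>ennreal\<close>; the
  logarithm is extended by \<open>log 0 = -\<infinity>\<close> and \<open>log \<infinity> = \<infinity>\<close>.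
\<close>

definition log_ennreal :: "ennreal \<Rightarrow> ereal" where
  "log_ennreal x =
     (if x = 0 then -\<infinity> else if x = \<infinity> then \<infinity> else ereal (ln (enn2real x)))"

subsection \<open>Scale pressure\<close>

definition dist_on :: "('g \<Rightarrow> 'x::metric_space \<Rightarrow> 'x) \<Rightarrow> 'g set \<Rightarrow> 'x \<Rightarrow> 'x \<Rightarrow> real" where
  "dist_on act F x y = (MAX g\<in>F. dist (act g x) (act g y))"

definition spanning ::
    "'x::metric_space set \<Rightarrow> ('g \<Rightarrow> 'x \<Rightarrow> 'x) \<Rightarrow> 'g set \<Rightarrow> real \<Rightarrow> 'x set \<Rightarrow> bool" where
  "spanning X act F \<epsilon> J \<longleftrightarrow> J \<subseteq> X \<and> (\<forall>x\<in>X. \<exists>y\<in>J. dist_on act F x y < \<epsilon>)"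

definition pressure_sum ::
    "'x::metric_space set \<Rightarrow> ('g \<Rightarrow> 'x \<Rightarrow> 'x) \<Rightarrow> ('x \<Rightarrow> real) \<Rightarrow> (real \<Rightarrow> real) \<Rightarrow> real \<Rightarrow>
       'g set \<Rightarrow> ennreal" where
  "pressure_sum X act \<phi> s \<epsilon> F =
     (INF J \<in> {J. spanning X act F \<epsilon> J}.
        \<Sum>\<^sub>\<infinity>x\<in>J. ennreal (exp (s \<epsilon> * (\<Sum>g\<in>F. \<phi> (act g x)))))"

definition scale_pressure ::
    "'x::metric_space set \<Rightarrow> ('g \<Rightarrow> 'x \<Rightarrow> 'x) \<Rightarrow> (nat \<Rightarrow> 'g set) \<Rightarrow> ('x \<Rightarrow> real) \<Rightarrow>
       (real \<Rightarrow> real) \<Rightarrow> ereal" where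
  "scale_pressure X act F \<phi> s =
     Limsup (at_right 0) (\<lambda>\<epsilon>.
       limsup (\<lambda>n. ereal (1 / real (card (F n))) * log_ennreal (pressure_sum X act \<phi> s \<epsilon> (F n)))
         / ereal (s \<epsilon>))"

subsection \<open>Scale pressure with respect to pseudo-orbits\<close>

text \<open>
  Families indexed by the group are extensional functions on its carrier, so that distinct
  functions are distinct families.
\<close>

definition pseudo_orbits ::
    "('g, 'b) monoid_scheme \<Rightarrow> 'g set \<Rightarrow> 'x::metric_space set \<Rightarrow> ('g \<Rightarrow> 'x \<Rightarrow> 'x) \<Rightarrow> real \<Rightarrow>
       ('g \<Rightarrow> 'x) set" where
  "pseudo_orbits G gens X act \<theta> =
     {y \<in> carrier G \<rightarrow>\<^sub>E X. \<forall>t\<in>gens. \<forall>g\<in>carrier G. dist (y (t \<otimes>\<^bsub>G\<^esub> g)) (act t (y g)) < \<theta>}"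

definition po_spanning ::
    "('g, 'b) monoid_scheme \<Rightarrow> 'x::metric_space set \<Rightarrow> 'g set \<Rightarrow> real \<Rightarrow> ('g \<Rightarrow> 'x) set \<Rightarrow>
       ('g \<Rightarrow> 'x) set \<Rightarrow> bool" where
  "po_spanning G X F \<epsilon> K J \<longleftrightarrow>
     J \<subseteq> (carrier G \<rightarrow>\<^sub>E X) \<and> (\<forall>x\<in>K. \<exists>y\<in>J. \<forall>g\<in>F. dist (x g) (y g) \<le> \<epsilon>)"

definition po_pressure_sum ::
    "('g, 'b) monoid_scheme \<Rightarrow> 'x::metric_space set \<Rightarrow> ('x \<Rightarrow> real) \<Rightarrow> (real \<Rightarrow> real) \<Rightarrow> real \<Rightarrow>
       'g set \<Rightarrow> ('g \<Rightarrow> 'x) set \<Rightarrow> ennreal" where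
  "po_pressure_sum G X \<phi> s \<epsilon> F Y =
     (INF J \<in> {J. po_spanning G X F \<epsilon> Y J}.
        \<Sum>\<^sub>\<infinity>x\<in>J. ennreal (exp (s \<epsilon> * (\<Sum>g\<in>F. \<phi> (x g)))))"

definition po_scale_pressure ::
    "('g, 'b) monoid_scheme \<Rightarrow> 'g set \<Rightarrow> 'x::metric_space set \<Rightarrow> ('g \<Rightarrow> 'x \<Rightarrow> 'x) \<Rightarrow>
       (nat \<Rightarrow> 'g set) \<Rightarrow> ('x \<Rightarrow> real) \<Rightarrow> (real \<Rightarrow> real) \<Rightarrow> ereal" where
  "po_scale_pressure G gens X act F \<phi> s =
     Limsup (at_right 0) (\<lambda>\<epsilon>.
       limsup (\<lambda>n. ereal (1 / real (card (F n))) *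
           log_ennreal
             (Lim (at_right 0)
               (\<lambda>\<theta>. po_pressure_sum G X \<phi> s \<epsilon> (F n) (pseudo_orbits G gens X act \<theta>))))
         / ereal (s \<epsilon>))"

text \<open>The limit in \<open>\<theta>\<close> always exists, by monotonicity, so \<^const>\<open>Lim\<close> is meaningful above.\<close>

lemma po_pressure_sum_mono:
  assumes "Y \<subseteq> Z"
  shows "po_pressure_sum G X \<phi> s \<epsilon> F Y \<le> po_pressure_sum G X \<phi> s \<epsilon> F Z"
  unfolding po_pressure_sum_def po_spanning_def
  using assms by (intro INF_superset_mono) auto

lemma pseudo_orbits_mono:
  assumes "\<theta> \<le> \<theta>'"
  shows "pseudo_orbits G gens X act \<theta> \<subseteq> pseudo_orbits G gens X act \<theta>'"
  using assms by (fastforce simp: pseudo_orbits_def)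

lemma po_pressure_sum_tendsto:
  "((\<lambda>\<theta>. po_pressure_sum G X \<phi> s \<epsilon> F (pseudo_orbits G gens X act \<theta>)) \<longlongrightarrow>
     (INF \<theta>\<in>{0<..}. po_pressure_sum G X \<phi> s \<epsilon> F (pseudo_orbits G gens X act \<theta>))) (at_right 0)"
  using Lim_right_bound[of UNIV 0
      "\<lambda>\<theta>. po_pressure_sum G X \<phi> s \<epsilon> F (pseudo_orbits G gens X act \<theta>)" 0]
  by (simp add: po_pressure_sum_mono pseudo_orbits_mono)

end

theory Submission
  imports Defs
begin

text \<open>
  Fix a finite nonempty \<open>F \<subseteq> G\<close> and write \<open>Q\<^sub>\<epsilon>\<close> for the pressure sum over \<open>F\<close> and \<open>P\<^sub>\<epsilon>\<close> for
  the limit, as \<open>\<theta> \<rightarrow> 0\<close>, of the pressure sums over \<open>\<theta>\<close>-pseudo-orbits. The two are compared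
  before the averaging over the Folner sequence.

  The first bound is \<open>P\<^sub>\<epsilon> \<le> Q\<^sub>\<epsilon>\<close> (\<open>po_pressure_sum_le_pressure_sum\<close>). Each element of \<open>F\<close> is a word in
  the generators and their inverses, and all of these act uniformly continuously on the compact
  space, so on \<open>F\<close> a \<open>\<theta>\<close>-pseudo-orbit \<open>y\<close> stays as close as desired to the orbit of \<open>y \<one>\<close> when
  \<open>\<theta>\<close> is small. Spanning sets of points are defined by a strict inequality, and by compactness
  such a set still spans at a radius slightly below \<open>\<epsilon>\<close>. The slack absorbs the distance between
  pseudo-orbit and orbit, so the orbits of the points of a spanning set span the pseudo-orbits.

  The second bound goes from \<open>P\<close> to \<open>Q\<close> and costs a change of radius
  (\<open>exp_mult_pressure_sum_le\<close>). A set of families that spans the pseudo-orbits at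
  radius \<open>\<eta>\<close> spans in particular the true orbits. Replacing each family by a point whose orbit
  is \<open>\<eta>\<close>-close to it gives a set that spans \<open>X\<close> at every radius \<open>\<epsilon> > 2\<eta>\<close>. Each exponent
  grows by at most \<open>|F| (s \<epsilon> \<omega> + |s \<epsilon> - s \<eta>| M)\<close>, where \<open>M\<close> bounds \<open>|\<phi>|\<close> and \<open>\<omega>\<close> is the
  oscillation of \<open>\<phi>\<close> at scale \<open>\<eta>\<close>. For \<open>\<eta> = \<epsilon> / 3\<close>, dividing by \<open>|F| s \<epsilon>\<close> leaves an error
  \<open>\<omega> + |1 - s (\<epsilon> / 3) / s \<epsilon>| M\<close>, which tends to \<open>0\<close> because \<open>\<phi>\<close> is uniformly
  continuous and \<open>s\<close> is a scale function. The same property of \<open>s\<close> makes the normalisations by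
  \<open>s \<epsilon>\<close> and by \<open>s (\<epsilon> / 3)\<close> interchangeable in the limit superior
  (\<open>Limsup_le_rescaled\<close>).
\<close>

section \<open>Sums and logarithms of extended nonnegative reals\<close>

text \<open>
  Passing to an image can only merge terms, so the sum does not grow: a finite part of the
  image lifts to a finite part of \<open>J\<close> on which \<open>f\<close> is injective.
\<close>

lemma infsum_image_le:
  fixes g :: "'b \<Rightarrow> ennreal" and h :: "'a \<Rightarrow> ennreal"
  assumes "\<And>x. x \<in> J \<Longrightarrow> g (f x) \<le> c * h x"
  shows "infsum g (f ` J) \<le> c * infsum h J"
proof -
  have "sum g S \<le> c * infsum h J" if "finite S" "S \<subseteq> f ` J" for S
  proof -
    obtain U where U: "U \<subseteq> J" "inj_on f U" "S = f ` U"
      using \<open>S \<subseteq> f ` J\<close> by (auto simp: subset_image_inj)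
    have fin: "finite U"
      using U \<open>finite S\<close> finite_imageD by blast
    have "sum g S = (\<Sum>x\<in>U. g (f x))"
      using U by (simp add: sum.reindex)
    also have "\<dots> \<le> (\<Sum>x\<in>U. c * h x)"
      using assms U by (intro sum_mono) auto
    also have "\<dots> = c * sum h U"
      by (simp add: sum_distrib_left)
    also have "\<dots> \<le> c * infsum h J"
      using U fin by (intro mult_left_mono)
        (auto simp: nonneg_infsum_complete intro!: SUP_upper)
    finally show ?thesis .
  qed
  then show ?thesis
    by (auto simp: nonneg_infsum_complete[of _ g] intro!: SUP_least)
qed

lemma log_ennreal_mono:
  assumes "x \<le> y"
  shows "log_ennreal x \<le> log_ennreal y"
proof (cases "x = 0 \<or> y = \<infinity>")
  case False
  then have "0 < enn2real x" "enn2real x \<le> enn2real y"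
    using assms
    by (auto simp: enn2real_positive_iff enn2real_mono less_top neq_top_trans top.not_eq_extremum
        zero_less_iff_neq_zero intro: le_less_trans)
  with False assms show ?thesis
    by (auto simp: log_ennreal_def top_unique)
qed (auto simp: log_ennreal_def)

lemma log_ennreal_exp_mult:
  "log_ennreal (ennreal (exp c) * x) = log_ennreal x + ereal c"
proof (cases x)
  case (real r)
  then show ?thesis
    by (auto simp: log_ennreal_def ennreal_mult'[symmetric] ln_mult)
next
  case top
  then show ?thesis
    by (simp add: log_ennreal_def ennreal_mult_top)
qed

section \<open>Pseudo-orbits near orbits\<close>

context lipschitz_system
begin

lemma act_in_space: "g \<in> carrier G \<Longrightarrow> x \<in> X \<Longrightarrow> act g x \<in> X"
  using element_image by blast

lemma act_one: "x \<in> X \<Longrightarrow> act \<one> x = x"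
  using id_eq_one by (metis restrict_apply')

lemma gens_in_carrier: "t \<in> gens \<Longrightarrow> t \<in> carrier G"
  using gens_subset by blast

lemma is_group: "group G"
  using group_hom by (rule group_hom.axioms(1))

lemma act_inv_act: "g \<in> carrier G \<Longrightarrow> x \<in> X \<Longrightarrow> act (inv g) (act g x) = x"
  using composition_rule[of x "inv g" g] act_one is_group
  by (simp add: group.l_inv)

lemma continuous_on_act: "g \<in> carrier G \<Longrightarrow> continuous_on X (act g)"
  using act_homeomorphism homeomorphism_def by blast

lemma act_uniformly_continuous:
  assumes "g \<in> carrier G" "\<delta> > 0"
  obtains \<rho> where "\<rho> > 0"
    "\<And>x y. x \<in> X \<Longrightarrow> y \<in> X \<Longrightarrow> dist x y < \<rho> \<Longrightarrow> dist (act g x) (act g y) < \<delta>"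
  using compact_uniformly_continuous[OF continuous_on_act[OF assms(1)] compact_space] assms(2)
  unfolding uniformly_continuous_on_def by metis

text \<open>
  Along a word in the generators, each further letter adds an error that its uniform
  continuity controls. The base point \<open>h\<close> is arbitrary because the induction over a product
  \<open>h1 \<otimes> h2\<close> moves the base point of \<open>h1\<close> to \<open>h2 \<otimes> h\<close>.
\<close>

lemma pseudo_orbit_near_translate:
  assumes "g \<in> generate G gens" "\<delta> > 0"
  shows "\<exists>\<theta>>0. \<forall>y\<in>pseudo_orbits G gens X act \<theta>. \<forall>h\<in>carrier G.
           dist (y (g \<otimes> h)) (act g (y h)) < \<delta>"
  using assms
proof (induction arbitrary: \<delta> rule: generate.induct)
  case one
  interpret group G by (rule is_group)
  have "dist (y (\<one> \<otimes> h)) (act \<one> (y h)) < \<delta>"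
    if "y \<in> pseudo_orbits G gens X act 1" "h \<in> carrier G" for y h
  proof -
    have "y h \<in> X" using that by (auto simp: pseudo_orbits_def)
    then show ?thesis using that one by (simp add: act_one)
  qed
  then show ?case
    using zero_less_one by blast
next
  case (incl t)
  then have "\<forall>y\<in>pseudo_orbits G gens X act \<delta>. \<forall>h\<in>carrier G. dist (y (t \<otimes> h)) (act t (y h)) < \<delta>"
    by (auto simp: pseudo_orbits_def)
  with incl show ?case by blast
next
  case (inv t)
  interpret group G by (rule is_group)
  have t: "t \<in> carrier G" using inv gens_in_carrier by blast
  obtain \<rho> where \<rho>: "\<rho> > 0"
    "\<And>x y. x \<in> X \<Longrightarrow> y \<in> X \<Longrightarrow> dist x y < \<rho> \<Longrightarrow> dist (act (inv t) x) (act (inv t) y) < \<delta>"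
    using act_uniformly_continuous[of "inv t" \<delta>] t inv by auto
  have "dist (y (inv t \<otimes> h)) (act (inv t) (y h)) < \<delta>"
    if y: "y \<in> pseudo_orbits G gens X act \<rho>" and h: "h \<in> carrier G" for y h
  proof -
    let ?k = "inv t \<otimes> h"
    have k: "?k \<in> carrier G" "t \<otimes> ?k = h"
      using t h by (auto simp: m_assoc[symmetric])
    have X: "y ?k \<in> X" "y h \<in> X"
      using y k h by (auto simp: pseudo_orbits_def)
    have "dist (y h) (act t (y ?k)) < \<rho>"
      using y k inv.hyps by (fastforce simp: pseudo_orbits_def)
    then have "dist (act (inv t) (y h)) (act (inv t) (act t (y ?k))) < \<delta>"
      using \<rho>(2) X act_in_space t by blast
    then show ?thesis
      using X t by (simp add: act_inv_act dist_commute)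
  qed
  with \<rho>(1) show ?case by blast
next
  case (eng h1 h2)
  interpret group G by (rule is_group)
  have c: "h1 \<in> carrier G" "h2 \<in> carrier G"
    using eng generate_gens by auto
  obtain \<rho> where \<rho>: "\<rho> > 0"
    "\<And>x y. x \<in> X \<Longrightarrow> y \<in> X \<Longrightarrow> dist x y < \<rho> \<Longrightarrow> dist (act h1 x) (act h1 y) < \<delta> / 2"
    using act_uniformly_continuous[of h1 "\<delta> / 2"] c eng by auto
  obtain \<theta>1 where \<theta>1: "\<theta>1 > 0" "\<And>y h. y \<in> pseudo_orbits G gens X act \<theta>1 \<Longrightarrow> h \<in> carrier G \<Longrightarrow>
      dist (y (h1 \<otimes> h)) (act h1 (y h)) < \<delta> / 2"
    using eng.IH(1)[of "\<delta> / 2"] eng.prems by auto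
  obtain \<theta>2 where \<theta>2: "\<theta>2 > 0" "\<And>y h. y \<in> pseudo_orbits G gens X act \<theta>2 \<Longrightarrow> h \<in> carrier G \<Longrightarrow>
      dist (y (h2 \<otimes> h)) (act h2 (y h)) < \<rho>"
    using eng.IH(2)[OF \<rho>(1)] by auto
  have "dist (y (h1 \<otimes> h2 \<otimes> h)) (act (h1 \<otimes> h2) (y h)) < \<delta>"
    if y: "y \<in> pseudo_orbits G gens X act (min \<theta>1 \<theta>2)" and h: "h \<in> carrier G" for y h
  proof -
    have y12: "y \<in> pseudo_orbits G gens X act \<theta>1" "y \<in> pseudo_orbits G gens X act \<theta>2"
      using y pseudo_orbits_mono[of "min \<theta>1 \<theta>2"] by (meson min.cobounded1 min.cobounded2 subsetD)+
    have X: "y h \<in> X" "y (h2 \<otimes> h) \<in> X" "act h2 (y h) \<in> X"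
      using y h c act_in_space by (auto simp: pseudo_orbits_def)
    have "dist (y (h1 \<otimes> (h2 \<otimes> h))) (act h1 (y (h2 \<otimes> h))) < \<delta> / 2"
      using \<theta>1(2) y12 c h by simp
    moreover have "dist (act h1 (y (h2 \<otimes> h))) (act h1 (act h2 (y h))) < \<delta> / 2"
      using \<rho>(2) \<theta>2(2) y12 h X by blast
    ultimately have "dist (y (h1 \<otimes> (h2 \<otimes> h))) (act h1 (act h2 (y h))) < \<delta>"
      using dist_triangle[of "y (h1 \<otimes> (h2 \<otimes> h))" "act h1 (act h2 (y h))" "act h1 (y (h2 \<otimes> h))"]
      by linarith
    then show ?thesis
      using X c h by (simp add: m_assoc composition_rule)
  qed
  moreover have "min \<theta>1 \<theta>2 > 0" using \<theta>1 \<theta>2 by simp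
  ultimately show ?case by blast
qed

lemma pseudo_orbits_near_orbits:
  assumes "finite F" "F \<subseteq> carrier G" "\<delta> > 0"
  shows "\<exists>\<theta>>0. \<forall>y\<in>pseudo_orbits G gens X act \<theta>. \<forall>g\<in>F. dist (y g) (act g (y \<one>)) < \<delta>"
  using assms
proof (induction F rule: finite_induct)
  case empty
  show ?case by (auto intro: exI[of _ 1])
next
  case (insert g F)
  interpret group G by (rule is_group)
  obtain \<theta>1 where \<theta>1: "\<theta>1 > 0"
    "\<forall>y\<in>pseudo_orbits G gens X act \<theta>1. \<forall>g\<in>F. dist (y g) (act g (y \<one>)) < \<delta>"
    using insert by auto
  obtain \<theta>2 where \<theta>2: "\<theta>2 > 0"
    "\<forall>y\<in>pseudo_orbits G gens X act \<theta>2. \<forall>h\<in>carrier G. dist (y (g \<otimes> h)) (act g (y h)) < \<delta>"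
    using pseudo_orbit_near_translate[of g \<delta>] insert.prems generate_gens by auto
  have "\<forall>y\<in>pseudo_orbits G gens X act \<theta>2. dist (y g) (act g (y \<one>)) < \<delta>"
    using \<theta>2(2) insert.prems by (metis insert_subset one_closed r_one)
  moreover have "pseudo_orbits G gens X act (min \<theta>1 \<theta>2) \<subseteq> pseudo_orbits G gens X act \<theta>1"
    "pseudo_orbits G gens X act (min \<theta>1 \<theta>2) \<subseteq> pseudo_orbits G gens X act \<theta>2"
    by (simp_all add: pseudo_orbits_mono)
  ultimately have "\<forall>y\<in>pseudo_orbits G gens X act (min \<theta>1 \<theta>2). \<forall>g\<in>insert g F.
      dist (y g) (act g (y \<one>)) < \<delta>"
    using \<theta>1(2) by blast
  moreover have "min \<theta>1 \<theta>2 > 0" using \<theta>1 \<theta>2 by simp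
  ultimately show ?case by blast
qed

definition orbit_family :: "'x \<Rightarrow> 'g \<Rightarrow> 'x" where
  "orbit_family x = (\<lambda>g\<in>carrier G. act g x)"

lemma orbit_family_extensional: "x \<in> X \<Longrightarrow> orbit_family x \<in> carrier G \<rightarrow>\<^sub>E X"
  using act_in_space by (auto simp: orbit_family_def)

lemma orbit_family_pseudo_orbit:
  assumes "x \<in> X" "\<theta> > 0"
  shows "orbit_family x \<in> pseudo_orbits G gens X act \<theta>"
proof -
  interpret group G by (rule is_group)
  show ?thesis
    using assms orbit_family_extensional gens_in_carrier
    by (auto simp: pseudo_orbits_def orbit_family_def composition_rule)
qed

section \<open>The pseudo-orbit sum is at most the pressure sum\<close>

text \<open>
  The radius at which \<open>J\<close> spans near a point is \<open>< \<epsilon>\<close> at that point and, by continuity, below a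
  common bound \<open>< \<epsilon>\<close> on a neighbourhood; finitely many neighbourhoods cover \<open>X\<close>. This uniform
  slack is what allows orbits to be replaced by nearby pseudo-orbits without enlarging \<open>\<epsilon>\<close>.
\<close>

lemma spanning_slack:
  assumes F: "finite F" "F \<noteq> {}" "F \<subseteq> carrier G" and J: "spanning X act F \<epsilon> J"
  obtains \<delta> where "\<delta> > 0"
    "\<And>x. x \<in> X \<Longrightarrow> \<exists>y\<in>J. \<forall>g\<in>F. dist (act g x) (act g y) < \<epsilon> - \<delta>"
proof -
  have local: "\<exists>\<rho>>0. \<exists>\<delta>>0. \<exists>y\<in>J. \<forall>x'\<in>X \<inter> ball x \<rho>. \<forall>g\<in>F. dist (act g x') (act g y) < \<epsilon> - \<delta>"
    if x: "x \<in> X" for x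
  proof -
    obtain y where y: "y \<in> J" "dist_on act F x y < \<epsilon>"
      using J x by (auto simp: spanning_def)
    define \<delta> where "\<delta> = (\<epsilon> - dist_on act F x y) / 2"
    have \<delta>: "\<delta> > 0" using y by (simp add: \<delta>_def)
    have close: "dist (act g x) (act g y) \<le> \<epsilon> - 2 * \<delta>" if "g \<in> F" for g
    proof -
      have "dist (act g x) (act g y) \<le> dist_on act F x y"
        unfolding dist_on_def using that F(1) by (intro Max_ge) simp_all
      then show ?thesis by (simp add: \<delta>_def field_simps)
    qed
    have "\<exists>\<rho>>0. \<forall>x'\<in>X. dist x x' < \<rho> \<longrightarrow> dist (act g x) (act g x') < \<delta>" if "g \<in> F" for g
      using act_uniformly_continuous[of g \<delta>] that F(3) \<delta> x by (metis subsetD)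
    then obtain r where r: "\<And>g. g \<in> F \<Longrightarrow> r g > 0"
      "\<And>g x'. g \<in> F \<Longrightarrow> x' \<in> X \<Longrightarrow> dist x x' < r g \<Longrightarrow> dist (act g x) (act g x') < \<delta>"
      by metis
    define \<rho> where "\<rho> = Min (r ` F)"
    have "\<rho> > 0" using r F by (simp add: \<rho>_def)
    moreover have "dist (act g x') (act g y) < \<epsilon> - \<delta>" if "x' \<in> X \<inter> ball x \<rho>" "g \<in> F" for x' g
    proof -
      have "\<rho> \<le> r g" using that F by (simp add: \<rho>_def)
      then have "dist (act g x) (act g x') < \<delta>" using r(2)[of g x'] that by simp
      then show ?thesis
        using close[OF that(2)] dist_triangle3[of "act g x'" "act g y" "act g x"] by linarith
    qed
    ultimately show ?thesis using \<delta> y(1) by blast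
  qed
  then obtain \<rho> \<delta>' where \<rho>: "\<And>x. x \<in> X \<Longrightarrow> \<rho> x > 0" and \<delta>': "\<And>x. x \<in> X \<Longrightarrow> \<delta>' x > 0"
    and span: "\<And>x x'. x \<in> X \<Longrightarrow> x' \<in> X \<inter> ball x (\<rho> x) \<Longrightarrow>
      \<exists>y\<in>J. \<forall>g\<in>F. dist (act g x') (act g y) < \<epsilon> - \<delta>' x"
    by metis
  obtain C where C: "C \<subseteq> X" "finite C" "X \<subseteq> (\<Union>x\<in>C. ball x (\<rho> x))"
    using compactE_image[OF compact_space, of X "\<lambda>x. ball x (\<rho> x)"] \<rho> by force
  \<comment> \<open>The extra element \<open>1\<close> keeps the minimum defined when \<open>X\<close> is empty.\<close>
  define \<delta> where "\<delta> = Min (insert 1 (\<delta>' ` C))"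
  show ?thesis
  proof
    show "\<delta> > 0" using C \<delta>' by (auto simp: \<delta>_def)
    fix x assume x: "x \<in> X"
    then obtain c where c: "c \<in> C" "x \<in> ball c (\<rho> c)" using C by blast
    have "\<delta> \<le> \<delta>' c" using c C by (simp add: \<delta>_def)
    with span[of c x] c C x show "\<exists>y\<in>J. \<forall>g\<in>F. dist (act g x) (act g y) < \<epsilon> - \<delta>"
      by (smt (verit) IntI subsetD)
  qed
qed

text \<open>
  For each spanning \<open>J\<close> some \<open>\<theta>\<close> makes the orbits of \<open>J\<close> span the \<open>\<theta>\<close>-pseudo-orbits at the
  same radius. This \<open>\<theta>\<close> depends on \<open>J\<close> and \<open>F\<close>, which is harmless because the infimum over
  \<open>\<theta>\<close> is taken with \<open>F\<close> fixed.
\<close>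

lemma po_pressure_sum_le_pressure_sum:
  assumes F: "finite F" "F \<noteq> {}" "F \<subseteq> carrier G"
  shows "(INF \<theta>\<in>{0<..}. po_pressure_sum G X \<phi> s \<epsilon> F (pseudo_orbits G gens X act \<theta>))
           \<le> pressure_sum X act \<phi> s \<epsilon> F"
  unfolding pressure_sum_def
proof (rule INF_greatest)
  fix J assume "J \<in> {J. spanning X act F \<epsilon> J}"
  then have J: "spanning X act F \<epsilon> J" by simp
  then have JX: "J \<subseteq> X" by (simp add: spanning_def)
  interpret group G by (rule is_group)
  obtain \<delta> where \<delta>: "\<delta> > 0" "\<And>x. x \<in> X \<Longrightarrow> \<exists>y\<in>J. \<forall>g\<in>F. dist (act g x) (act g y) < \<epsilon> - \<delta>"
    using spanning_slack[OF F J] by blast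
  obtain \<theta> where \<theta>: "\<theta> > 0"
    "\<And>y g. y \<in> pseudo_orbits G gens X act \<theta> \<Longrightarrow> g \<in> F \<Longrightarrow> dist (y g) (act g (y \<one>)) < \<delta>"
    using pseudo_orbits_near_orbits[OF F(1,3) \<delta>(1)] by blast
  let ?P = "pseudo_orbits G gens X act \<theta>"
  have "\<exists>z\<in>orbit_family ` J. \<forall>g\<in>F. dist (y g) (z g) \<le> \<epsilon>" if y: "y \<in> ?P" for y
  proof -
    have "y \<one> \<in> X" using y by (auto simp: pseudo_orbits_def)
    then obtain x where x: "x \<in> J" "\<forall>g\<in>F. dist (act g (y \<one>)) (act g x) < \<epsilon> - \<delta>"
      using \<delta>(2) by blast
    have "dist (y g) (orbit_family x g) \<le> \<epsilon>" if "g \<in> F" for g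
    proof -
      have "dist (y g) (act g x) < \<delta> + (\<epsilon> - \<delta>)"
        using \<theta>(2)[OF y that] x(2) that dist_triangle[of "y g" "act g x" "act g (y \<one>)"]
        by fastforce
      then show ?thesis using that F by (auto simp: orbit_family_def)
    qed
    then show ?thesis using x(1) by blast
  qed
  moreover have "orbit_family ` J \<subseteq> carrier G \<rightarrow>\<^sub>E X"
    by (rule image_subsetI) (rule orbit_family_extensional, use JX in blast)
  ultimately have span: "po_spanning G X F \<epsilon> ?P (orbit_family ` J)"
    by (simp only: po_spanning_def) simp
  have "(INF \<theta>\<in>{0<..}. po_pressure_sum G X \<phi> s \<epsilon> F (pseudo_orbits G gens X act \<theta>))
      \<le> po_pressure_sum G X \<phi> s \<epsilon> F ?P"
    using \<theta>(1) by (intro INF_lower) simp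
  also have "\<dots> \<le> (\<Sum>\<^sub>\<infinity>x\<in>orbit_family ` J. ennreal (exp (s \<epsilon> * (\<Sum>g\<in>F. \<phi> (x g)))))"
    unfolding po_pressure_sum_def using span by (intro INF_lower) simp
  also have "\<dots> \<le> 1 * (\<Sum>\<^sub>\<infinity>x\<in>J. ennreal (exp (s \<epsilon> * (\<Sum>g\<in>F. \<phi> (act g x)))))"
  proof (rule infsum_image_le)
    fix x assume "x \<in> J"
    have "(\<Sum>g\<in>F. \<phi> (orbit_family x g)) = (\<Sum>g\<in>F. \<phi> (act g x))"
      using F by (intro sum.cong) (auto simp: orbit_family_def)
    then show "ennreal (exp (s \<epsilon> * (\<Sum>g\<in>F. \<phi> (orbit_family x g))))
        \<le> 1 * ennreal (exp (s \<epsilon> * (\<Sum>g\<in>F. \<phi> (act g x))))"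
      by simp
  qed
  finally show "(INF \<theta>\<in>{0<..}. po_pressure_sum G X \<phi> s \<epsilon> F (pseudo_orbits G gens X act \<theta>))
      \<le> (\<Sum>\<^sub>\<infinity>x\<in>J. ennreal (exp (s \<epsilon> * (\<Sum>g\<in>F. \<phi> (act g x)))))"
    by simp
qed

section \<open>The pressure sum is almost bounded by the pseudo-orbit sum\<close>

text \<open>
  Families of a spanning set \<open>J\<close> that are \<open>\<eta>\<close>-close on \<open>F\<close> to the orbit of some point are
  replaced by such a point, and the other families are dropped, which only lowers the sum. The two
  errors per group element come from moving \<open>\<phi>\<close> over a distance \<open>\<eta>\<close> and from exchanging
  \<open>s \<eta>\<close> for \<open>s \<epsilon>\<close>. The exponential factor stands on the side of the pressure sum, so that the
  infimum over \<open>J\<close> can be taken on the other side without being multiplied.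
\<close>

lemma exp_mult_pressure_sum_le:
  assumes F: "finite F" "F \<noteq> {}" "F \<subseteq> carrier G"
    and Y: "\<And>x. x \<in> X \<Longrightarrow> orbit_family x \<in> Y"
    and M: "\<And>x. x \<in> X \<Longrightarrow> \<bar>\<phi> x\<bar> \<le> M"
    and \<omega>: "\<And>x y. x \<in> X \<Longrightarrow> y \<in> X \<Longrightarrow> dist x y \<le> \<eta> \<Longrightarrow> \<bar>\<phi> x - \<phi> y\<bar> \<le> \<omega>"
    and \<eta>: "2 * \<eta> < \<epsilon>" and s: "0 \<le> s \<epsilon>"
  shows "ennreal (exp (- (real (card F) * (s \<epsilon> * \<omega> + \<bar>s \<epsilon> - s \<eta>\<bar> * M)))) *
           pressure_sum X act \<phi> s \<epsilon> F \<le> po_pressure_sum G X \<phi> s \<eta> F Y"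
  unfolding po_pressure_sum_def
proof (rule INF_greatest)
  fix J assume "J \<in> {J. po_spanning G X F \<eta> Y J}"
  then have J: "J \<subseteq> carrier G \<rightarrow>\<^sub>E X" "\<And>x. x \<in> Y \<Longrightarrow> \<exists>y\<in>J. \<forall>g\<in>F. dist (x g) (y g) \<le> \<eta>"
    by (auto simp: po_spanning_def)
  let ?k = "real (card F) * (s \<epsilon> * \<omega> + \<bar>s \<epsilon> - s \<eta>\<bar> * M)"
  define J' where "J' = {y \<in> J. \<exists>x\<in>X. \<forall>g\<in>F. dist (act g x) (y g) \<le> \<eta>}"
  define p where "p y = (SOME x. x \<in> X \<and> (\<forall>g\<in>F. dist (act g x) (y g) \<le> \<eta>))" for y
  have p: "p y \<in> X \<and> (\<forall>g\<in>F. dist (act g (p y)) (y g) \<le> \<eta>)" if "y \<in> J'" for y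
    unfolding p_def by (rule someI_ex) (use that J'_def in auto)
  have "\<exists>y\<in>p ` J'. dist_on act F x y < \<epsilon>" if x: "x \<in> X" for x
  proof -
    obtain y where y: "y \<in> J" "\<forall>g\<in>F. dist (orbit_family x g) (y g) \<le> \<eta>"
      using J(2)[OF Y[OF x]] by blast
    then have xy: "\<forall>g\<in>F. dist (act g x) (y g) \<le> \<eta>"
      using F by (auto simp: orbit_family_def subset_iff)
    then have y': "y \<in> J'" using y x by (auto simp: J'_def)
    have "dist (act g x) (act g (p y)) < \<epsilon>" if "g \<in> F" for g
      using xy p[OF y'] that \<eta> dist_triangle2[of "act g x" "act g (p y)" "y g"] by fastforce
    then have "dist_on act F x (p y) < \<epsilon>" using F by (simp add: dist_on_def)
    then show ?thesis using y' by blast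
  qed
  then have span: "spanning X act F \<epsilon> (p ` J')"
    using p by (auto simp: spanning_def)
  have exponent: "s \<epsilon> * (\<Sum>g\<in>F. \<phi> (act g (p y))) \<le> ?k + s \<eta> * (\<Sum>g\<in>F. \<phi> (y g))" if y: "y \<in> J'" for y
  proof -
    have "s \<epsilon> * \<phi> (act g (p y)) \<le> (s \<epsilon> * \<omega> + \<bar>s \<epsilon> - s \<eta>\<bar> * M) + s \<eta> * \<phi> (y g)" if g: "g \<in> F" for g
    proof -
      have gG: "g \<in> carrier G" using g F(3) by blast
      have "y \<in> carrier G \<rightarrow>\<^sub>E X" using y J(1) by (auto simp only: J'_def)
      then have X: "act g (p y) \<in> X" "y g \<in> X"
        using p[OF y] act_in_space[OF gG] PiE_mem[OF _ gG] by blast+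
      have "s \<epsilon> * (\<phi> (act g (p y)) - \<phi> (y g)) \<le> s \<epsilon> * \<omega>"
        using \<omega>[OF X] p[OF y] g s by (intro mult_left_mono) auto
      moreover have "(s \<epsilon> - s \<eta>) * \<phi> (y g) \<le> \<bar>s \<epsilon> - s \<eta>\<bar> * M"
      proof -
        have "(s \<epsilon> - s \<eta>) * \<phi> (y g) \<le> \<bar>s \<epsilon> - s \<eta>\<bar> * \<bar>\<phi> (y g)\<bar>"
          by (simp add: abs_mult[symmetric])
        also have "\<dots> \<le> \<bar>s \<epsilon> - s \<eta>\<bar> * M"
          using M[OF X(2)] by (rule mult_left_mono) simp
        finally show ?thesis .
      qed
      ultimately show ?thesis
        unfolding left_diff_distrib right_diff_distrib by linarith
    qed
    then have "(\<Sum>g\<in>F. s \<epsilon> * \<phi> (act g (p y)))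
        \<le> (\<Sum>g\<in>F. (s \<epsilon> * \<omega> + \<bar>s \<epsilon> - s \<eta>\<bar> * M) + s \<eta> * \<phi> (y g))"
      by (rule sum_mono)
    then show ?thesis
      by (simp add: sum.distrib sum_distrib_left)
  qed
  have "pressure_sum X act \<phi> s \<epsilon> F
      \<le> (\<Sum>\<^sub>\<infinity>x\<in>p ` J'. ennreal (exp (s \<epsilon> * (\<Sum>g\<in>F. \<phi> (act g x)))))"
    unfolding pressure_sum_def using span by (intro INF_lower) simp
  also have "\<dots> \<le> ennreal (exp ?k) * (\<Sum>\<^sub>\<infinity>y\<in>J'. ennreal (exp (s \<eta> * (\<Sum>g\<in>F. \<phi> (y g)))))"
    using exponent
    by (intro infsum_image_le) (simp add: ennreal_mult[symmetric] exp_add[symmetric])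
  also have "\<dots> \<le> ennreal (exp ?k) * (\<Sum>\<^sub>\<infinity>y\<in>J. ennreal (exp (s \<eta> * (\<Sum>g\<in>F. \<phi> (y g)))))"
    by (intro mult_left_mono infsum_mono_neutral nonneg_summable_on_complete) (auto simp: J'_def)
  finally have "ennreal (exp (- ?k)) * pressure_sum X act \<phi> s \<epsilon> F \<le> ennreal (exp (- ?k)) *
      (ennreal (exp ?k) * (\<Sum>\<^sub>\<infinity>y\<in>J. ennreal (exp (s \<eta> * (\<Sum>g\<in>F. \<phi> (y g))))))"
    by (rule mult_left_mono) simp
  also have "\<dots> = (\<Sum>\<^sub>\<infinity>y\<in>J. ennreal (exp (s \<eta> * (\<Sum>g\<in>F. \<phi> (y g)))))"
    unfolding mult.assoc[symmetric]
    by (simp add: ennreal_mult[symmetric] exp_add[symmetric] del: mult_minus_right)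
  finally show "ennreal (exp (- ?k)) * pressure_sum X act \<phi> s \<epsilon> F
      \<le> (\<Sum>\<^sub>\<infinity>y\<in>J. ennreal (exp (s \<eta> * (\<Sum>g\<in>F. \<phi> (y g)))))" .
qed

end

section \<open>Growth rates and change of scale\<close>

lemma growth_rate_le:
  fixes Q P :: "nat \<Rightarrow> ennreal" and N :: "nat \<Rightarrow> nat"
  assumes le: "\<And>n. ennreal (exp (- (real (N n) * c))) * Q n \<le> P n" and N: "\<And>n. N n > 0"
  shows "limsup (\<lambda>n. ereal (1 / real (N n)) * log_ennreal (Q n))
           \<le> limsup (\<lambda>n. ereal (1 / real (N n)) * log_ennreal (P n)) + ereal c"
proof -
  have "ereal (1 / real (N n)) * log_ennreal (Q n)
      \<le> ereal (1 / real (N n)) * log_ennreal (P n) + ereal c" for n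
  proof -
    have "log_ennreal (Q n) + ereal (- (real (N n) * c)) \<le> log_ennreal (P n)"
      using log_ennreal_mono[OF le[of n]] by (simp add: log_ennreal_exp_mult)
    then show ?thesis
      using N[of n]
      by (cases "log_ennreal (Q n)"; cases "log_ennreal (P n)") (auto simp: field_simps)
  qed
  then have "limsup (\<lambda>n. ereal (1 / real (N n)) * log_ennreal (Q n))
      \<le> limsup (\<lambda>n. ereal (1 / real (N n)) * log_ennreal (P n) + ereal c)"
    by (intro Limsup_mono) simp
  then show ?thesis
    by (simp add: Limsup_add_ereal_right)
qed

text \<open>
  The factor \<open>s (l * x) / s x\<close> that appears when the normalisation changes tends to \<open>1\<close>, hence
  disappears in the limit superior, and so does an error that is eventually below every \<open>\<kappa> > 0\<close>
  relative to \<open>s\<close>.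
\<close>

lemma Limsup_le_rescaled:
  fixes A B :: "real \<Rightarrow> ereal" and s :: "real \<Rightarrow> real"
  assumes s: "s \<in> scale_functions" and l: "0 < l"
    and bound: "\<And>\<kappa>. \<kappa> > 0 \<Longrightarrow> \<forall>\<^sub>F x in at_right 0.
        A x \<le> B (l * x) + ereal (s x * \<kappa> + \<bar>s x - s (l * x)\<bar> * M)"
  shows "Limsup (at_right 0) (\<lambda>x. A x / ereal (s x)) \<le> Limsup (at_right 0) (\<lambda>x. B x / ereal (s x))"
proof (rule dense_ge)
  fix z assume z: "Limsup (at_right 0) (\<lambda>x. B x / ereal (s x)) < z"
  show "Limsup (at_right 0) (\<lambda>x. A x / ereal (s x)) \<le> z"
  proof (cases z)
    case (real K)
    obtain K' where K': "Limsup (at_right 0) (\<lambda>x. B x / ereal (s x)) < ereal K'" "K' < K"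
      using ereal_dense2[OF z] real by auto
    \<comment> \<open>Half of the gap goes to \<open>\<kappa>\<close>, the other half to the terms that converge with \<open>?r\<close>.\<close>
    define \<kappa> where "\<kappa> = (K - K') / 2"
    have \<kappa>: "\<kappa> > 0" using K' by (simp add: \<kappa>_def)
    let ?r = "\<lambda>x. s (l * x) / s x"
    have r: "(?r \<longlongrightarrow> 1) (at_right 0)"
      using s l by (auto simp: scale_functions_def)
    have "((\<lambda>x. K' * ?r x + (\<kappa> + \<bar>1 - ?r x\<bar> * M)) \<longlongrightarrow> K' * 1 + (\<kappa> + \<bar>1 - 1\<bar> * M)) (at_right 0)"
      by (intro tendsto_intros r)
    moreover have "K' * 1 + (\<kappa> + \<bar>1 - 1\<bar> * M) < K"
      using K' by (simp add: \<kappa>_def field_simps)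
    ultimately have small: "\<forall>\<^sub>F x in at_right 0. K' * ?r x + (\<kappa> + \<bar>1 - ?r x\<bar> * M) < K"
      by (rule order_tendstoD(2))
    have lim: "filterlim (\<lambda>x. l * x) (at_right 0) (at_right 0)"
    proof -
      have "((\<lambda>x. l * x) \<longlongrightarrow> l * 0) (at_right 0)"
        by (intro tendsto_intros)
      then show ?thesis
        using l by (auto simp: filterlim_at eventually_at_filter)
    qed
    have Bl: "\<forall>\<^sub>F x in at_right 0. B (l * x) / ereal (s (l * x)) < ereal K'"
      using eventually_compose_filterlim[OF Limsup_lessD[OF K'(1)] lim] .
    have unit: "\<forall>\<^sub>F x::real in at_right 0. x \<in> {0<..<1}"
      by (simp add: eventually_at_right_field) (use zero_less_one in blast)
    have "\<forall>\<^sub>F x in at_right 0. A x / ereal (s x) \<le> z"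
      using small Bl unit eventually_compose_filterlim[OF unit lim] bound[OF \<kappa>]
    proof eventually_elim
      case (elim x)
      have pos: "s x > 0" "s (l * x) > 0"
        using elim s by (auto simp: scale_functions_def)
      have "B (l * x) \<le> ereal (K' * s (l * x))"
        using elim(2) pos by (cases "B (l * x)") (auto simp: field_simps)
      then have "A x \<le> ereal (K' * s (l * x)) + ereal (s x * \<kappa> + \<bar>s x - s (l * x)\<bar> * M)"
        using elim(5) by (meson add_right_mono order_trans)
      then have "A x / ereal (s x) \<le> ereal (K' * s (l * x) + (s x * \<kappa> + \<bar>s x - s (l * x)\<bar> * M)) / ereal (s x)"
        using pos by (intro ereal_divide_right_mono) auto
      also have "\<dots> = ereal (K' * ?r x + (\<kappa> + \<bar>1 - ?r x\<bar> * M))"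
      proof -
        have "\<bar>1 - ?r x\<bar> = \<bar>s x - s (l * x)\<bar> / s x"
        proof -
          have "1 - ?r x = (s x - s (l * x)) / s x"
            using pos by (simp add: diff_divide_distrib)
          then show ?thesis using pos by (simp add: abs_divide)
        qed
        then show ?thesis
          using pos by (simp add: add_divide_distrib)
      qed
      also have "\<dots> \<le> z" using elim(1) real by simp
      finally show ?case .
    qed
    then show ?thesis by (rule Limsup_bounded)
  qed (use z in auto)
qed

section \<open>Equality of the two pressures\<close>

theorem theoremB:
  fixes G :: "('g, 'b) monoid_scheme" and gens :: "'g set" and F :: "nat \<Rightarrow> 'g set"
    and X :: "'x::metric_space set" and act :: "'g \<Rightarrow> 'x \<Rightarrow> 'x"
    and s :: "real \<Rightarrow> real" and \<phi> :: "'x \<Rightarrow> real"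
  assumes "countable_amenable_group G"
    and "folner_sequence G F"
    and "lipschitz_system G gens X act"
    and "s \<in> noninc_scale_functions"
    and "continuous_on X \<phi>"
  shows "scale_pressure X act F \<phi> s = po_scale_pressure G gens X act F \<phi> s"
proof -
  interpret lipschitz_system G gens X act by fact
  have F: "finite (F n)" "F n \<noteq> {}" "F n \<subseteq> carrier G" for n
    using assms(2) by (auto simp: folner_sequence_def)
  then have N: "card (F n) > 0" for n by (simp add: card_gt_0_iff)
  have s: "s \<in> scale_functions"
    using assms(4) by (simp add: noninc_scale_functions_def)
  have unit: "\<forall>\<^sub>F x::real in at_right 0. x \<in> {0<..<1}"
    by (simp add: eventually_at_right_field) (use zero_less_one in blast)
  define P where "P \<epsilon> n =
    (INF \<theta>\<in>{0<..}. po_pressure_sum G X \<phi> s \<epsilon> (F n) (pseudo_orbits G gens X act \<theta>))" for \<epsilon> n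
  have Lim_P: "Lim (at_right 0)
      (\<lambda>\<theta>. po_pressure_sum G X \<phi> s \<epsilon> (F n) (pseudo_orbits G gens X act \<theta>)) = P \<epsilon> n" for \<epsilon> n
    unfolding P_def by (rule tendsto_Lim[OF _ po_pressure_sum_tendsto]) simp
  define A where "A \<epsilon> =
    limsup (\<lambda>n. ereal (1 / real (card (F n))) * log_ennreal (pressure_sum X act \<phi> s \<epsilon> (F n)))" for \<epsilon>
  define B where "B \<epsilon> = limsup (\<lambda>n. ereal (1 / real (card (F n))) * log_ennreal (P \<epsilon> n))" for \<epsilon>
  have SP: "scale_pressure X act F \<phi> s = Limsup (at_right 0) (\<lambda>\<epsilon>. A \<epsilon> / ereal (s \<epsilon>))"
    by (simp add: scale_pressure_def A_def)
  have PSP: "po_scale_pressure G gens X act F \<phi> s = Limsup (at_right 0) (\<lambda>\<epsilon>. B \<epsilon> / ereal (s \<epsilon>))"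
    by (simp add: po_scale_pressure_def B_def Lim_P)
  obtain M where M: "\<And>x. x \<in> X \<Longrightarrow> \<bar>\<phi> x\<bar> \<le> M"
    using compact_imp_bounded[OF compact_continuous_image[OF assms(5) compact_space]]
    by (auto simp: bounded_iff)
  show ?thesis
  proof (rule antisym)
    show "scale_pressure X act F \<phi> s \<le> po_scale_pressure G gens X act F \<phi> s"
      unfolding SP PSP
      \<comment> \<open>Any factor with \<open>0 < l < 1/2\<close> meets the condition \<open>2 * \<eta> < \<epsilon>\<close> on the radii.\<close>
    proof (rule Limsup_le_rescaled[OF s, where l = "1/3" and M = M])
      fix \<kappa> :: real assume "\<kappa> > 0"
      then obtain \<rho> where \<rho>: "\<rho> > 0"
        "\<And>x y. x \<in> X \<Longrightarrow> y \<in> X \<Longrightarrow> dist x y < \<rho> \<Longrightarrow> \<bar>\<phi> x - \<phi> y\<bar> < \<kappa>"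
        using compact_uniformly_continuous[OF assms(5) compact_space]
        unfolding uniformly_continuous_on_def dist_real_def by metis
      have "\<forall>\<^sub>F x::real in at_right 0. x < \<rho>"
        using \<rho>(1) by (auto simp: eventually_at_right_field)
      with unit
      show "\<forall>\<^sub>F x in at_right 0. A x \<le> B (1/3 * x) + ereal (s x * \<kappa> + \<bar>s x - s (1/3 * x)\<bar> * M)"
      proof eventually_elim
        case (elim x)
        show ?case
          unfolding A_def B_def
        proof (rule growth_rate_le[OF _ N])
          fix n
          show "ennreal (exp (- (real (card (F n)) * (s x * \<kappa> + \<bar>s x - s (1/3 * x)\<bar> * M)))) *
              pressure_sum X act \<phi> s x (F n) \<le> P (1/3 * x) n"
            unfolding P_def
          proof (rule INF_greatest, rule exp_mult_pressure_sum_le[OF F _ M])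
            show "orbit_family z \<in> pseudo_orbits G gens X act \<theta>"
              if "\<theta> \<in> {0<..}" "z \<in> X" for \<theta> z
              using that orbit_family_pseudo_orbit by simp
            show "\<bar>\<phi> z - \<phi> y\<bar> \<le> \<kappa>" if "z \<in> X" "y \<in> X" "dist z y \<le> 1/3 * x" for z y
              using \<rho>(2)[OF that(1,2)] that(3) elim by simp
            show "2 * (1/3 * x) < x" using elim by simp
            show "0 \<le> s x" using s elim by (simp add: scale_functions_def less_imp_le)
          qed
        qed
      qed
    qed simp
    show "po_scale_pressure G gens X act F \<phi> s \<le> scale_pressure X act F \<phi> s"
      unfolding SP PSP
    proof (rule Limsup_mono, use unit in eventually_elim)
      case (elim \<epsilon>)
      have "B \<epsilon> \<le> A \<epsilon>"
        unfolding A_def B_def P_def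
        by (intro Limsup_mono always_eventually allI ereal_mult_left_mono log_ennreal_mono
            po_pressure_sum_le_pressure_sum F) simp
      then show ?case
        using s elim by (intro ereal_divide_right_mono) (auto simp: scale_functions_def)
    qed
  qed
qed

end
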